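(* Assume $F:\mathcal X\times\Omega\to\mathbb R$ is convex in $\mathbf x\in\mathcal X$ for all $\omega\in\Omega$. Fix a block $\mathcal B\subseteq\{1,\dots,n\}$ with $|\mathcal B|\ge2$ and let $\mathcal B^c=\{1,\dots,n\}\setminus\mathcal B$. Then, for every $\mathbf r\in\operatorname{int}\mathcal Q$ and $\gamma>0$, $$\operatorname{prox}^{\mathcal B}_{\gamma\varphi}(\mathbf r)=\mathbf q^{\mathcal B}_{\gamma,\mathbf r}(\hat{\mathbf x},\hat t)\in\operatorname{int}\mathcal Q,$$ where $(\hat{\mathbf x},\hat t)$ solves $$(\hat{\mathbf x},\hat t)\in\arg\min_{\mathbf x\in\mathcal X,\,t\in\mathbb R}\Big\{t+\sum_{i\in\mathcal B^c}r_i\big(F_i(\mathbf x)-t\big)+\frac{1}{\gamma(1-\alpha)}\sum_{i\in\mathcal B}p_i\,h_i(\mathbf x,t;\mathbf r)\Big\}.$$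
   Context: Setting. $\Omega=\{\omega_1,\dots,\omega_n\}$ is finite with probability vector $\mathbf p$, $\alpha\in(0,1)$, $\mathcal Q_\alpha=\{\mathbf q\in\mathbb R^n:0\le q_i\le p_i/(1-\alpha)\ \forall i\}$, $\mathcal Q=\{\mathbf q\in\mathcal Q_\alpha:\sum_iq_i=1\}$, $\operatorname{int}\mathcal Q=\{\mathbf q\in\mathcal Q:0<q_i<p_i/(1-\alpha)\ \forall i\}$. $\mathcal X\subseteq\mathbb R^d$ is closed, convex, nonempty; $F_i(\mathbf x)=F(\mathbf x,\omega_i)$; $\mathbb E_{\mathbf q}[F(\mathbf x,\omega)]=\sum_iq_iF_i(\mathbf x)$. $\varphi(\mathbf q)=-\min_{\mathbf x\in\mathcal X}\mathbb E_{\mathbf q}[F(\mathbf x,\omega)]$ if $\sum_iq_i=1$ and $+\infty$ otherwise; as the notation presupposes, the minima are attained (for every $\mathbf q\in\mathcal Q$), and $(\hat{\mathbf x},\hat t)$ denotes any minimizer, assumed to exist. Generalized Fermi--Dirac entropy ($0\ln0=0$): $\psi(\mathbf q)=\sum_i[q_i\ln q_i+(\frac{p_i}{1-\alpha}-q_i)\ln(\frac{p_i}{1-\alpha}-q_i)]$ on $\mathcal Q_\alpha$, $+\infty$ elsewhere; componentwise derivative $\nabla_i\psi(r_i)=\ln\frac{r_i}{p_i/(1-\alpha)-r_i}$ with inverse $\nabla_i\psi^{-1}(s)=\frac{p_i}{1-\alpha}\frac{e^s}{1+e^s}$. Bregman divergence: $D_\psi(\mathbf q,\mathbf r)=\psi(\mathbf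 q)-\psi(\mathbf r)-\langle\nabla\psi(\mathbf r),\mathbf q-\mathbf r\rangle$. Block proximal operator: $\operatorname{prox}^{\mathcal B}_{\gamma\varphi}(\mathbf r)=\arg\min\{\gamma\varphi(\mathbf q)+D_\psi(\mathbf q,\mathbf r):\mathbf q\in\mathcal Q,\ q_i=r_i\ \forall i\in\mathcal B^c\}$. $h_i(\mathbf x,t;\mathbf r)=\ln\big(1+\exp(\nabla_i\psi(r_i)+\gamma(F_i(\mathbf x)-t))\big)$. Block dual update vector: $[\mathbf q^{\mathcal B}_{\gamma,\mathbf r}(\mathbf x,t)]_i=\nabla_i\psi^{-1}\big(\nabla_i\psi(r_i)+\gamma(F_i(\mathbf x)-t)\big)$ for $i\in\mathcal B$, and $=r_i$ for $i\in\mathcal B^c$. *)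

theory Defs
  imports "HOL-Analysis.Analysis"
begin

(* The sample space is identified with the finite index type 'n, so that F x i stands for
   F(x, omega_i) = F_i(x). *)

definition prob_vector :: "real^'n \<Rightarrow> bool" where
  "prob_vector p \<longleftrightarrow> (\<forall>i. 0 \<le> p $ i) \<and> (\<Sum>i\<in>UNIV. p $ i) = 1"

definition Q_box :: "real^'n \<Rightarrow> real \<Rightarrow> (real^'n) set" where
  "Q_box p \<alpha> = {q. \<forall>i. 0 \<le> q $ i \<and> q $ i \<le> p $ i / (1 - \<alpha>)}"

definition Q_set :: "real^'n \<Rightarrow> real \<Rightarrow> (real^'n) set" where
  "Q_set p \<alpha> = {q \<in> Q_box p \<alpha>. (\<Sum>i\<in>UNIV. q $ i) = 1}"

definition int_Q :: "real^'n \<Rightarrow> real \<Rightarrow> (real^'n) set" where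
  "int_Q p \<alpha> = {q \<in> Q_set p \<alpha>. \<forall>i. 0 < q $ i \<and> q $ i < p $ i / (1 - \<alpha>)}"

definition expect :: "real^'n \<Rightarrow> ('a \<Rightarrow> 'n \<Rightarrow> real) \<Rightarrow> 'a \<Rightarrow> real" where
  "expect q F x = (\<Sum>i\<in>UNIV. q $ i * F x i)"

(* The infimum is the minimum wherever the latter is attained; attainment for q in Q_set is a
   separate hypothesis. *)
definition phi :: "'a set \<Rightarrow> ('a \<Rightarrow> 'n \<Rightarrow> real) \<Rightarrow> real^'n \<Rightarrow> ereal" where
  "phi X F q = (if (\<Sum>i\<in>UNIV. q $ i) = 1 then - (INF x\<in>X. ereal (expect q F x)) else \<infinity>)"

(* The convention 0 ln 0 = 0 holds because 0 * y = 0. *)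
definition psi :: "real^'n \<Rightarrow> real \<Rightarrow> real^'n \<Rightarrow> ereal" where
  "psi p \<alpha> q = (if q \<in> Q_box p \<alpha>
     then ereal (\<Sum>i\<in>UNIV. q $ i * ln (q $ i)
                   + (p $ i / (1 - \<alpha>) - q $ i) * ln (p $ i / (1 - \<alpha>) - q $ i))
     else \<infinity>)"

definition dpsi :: "real^'n \<Rightarrow> real \<Rightarrow> 'n \<Rightarrow> real \<Rightarrow> real" where
  "dpsi p \<alpha> i s = ln (s / (p $ i / (1 - \<alpha>) - s))"

definition dpsi_inv :: "real^'n \<Rightarrow> real \<Rightarrow> 'n \<Rightarrow> real \<Rightarrow> real" where
  "dpsi_inv p \<alpha> i s = p $ i / (1 - \<alpha>) * (exp s / (1 + exp s))"

lemma has_real_derivative_dpsi: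
  assumes "0 < s" "s < p $ i / (1 - \<alpha>)"
  shows "((\<lambda>s. s * ln s + (p $ i / (1 - \<alpha>) - s) * ln (p $ i / (1 - \<alpha>) - s))
           has_real_derivative dpsi p \<alpha> i s) (at s)"
proof -
  define c where "c = p $ i / (1 - \<alpha>)"
  have "((\<lambda>s. s * ln s + (c - s) * ln (c - s)) has_real_derivative
           (ln s + s * (1 / s)) + (- ln (c - s) - (c - s) * (1 / (c - s)))) (at s)"
    using assms unfolding c_def[symmetric] by (auto intro!: derivative_eq_intros)
  then show ?thesis
    using assms unfolding dpsi_def c_def[symmetric] by (simp add: ln_div)
qed

lemma dpsi_dpsi_inv:
  assumes "0 < p $ i / (1 - \<alpha>)"
  shows "dpsi p \<alpha> i (dpsi_inv p \<alpha> i s) = s"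
proof -
  define c where "c = p $ i / (1 - \<alpha>)"
  have pos: "1 + exp s > 0" by (simp add: add_pos_pos)
  have "c - c * (exp s / (1 + exp s)) = c / (1 + exp s)"
    using pos by (simp add: field_simps)
  then have "c * (exp s / (1 + exp s)) / (c - c * (exp s / (1 + exp s))) = exp s"
    using assms pos unfolding c_def[symmetric] by simp
  then show ?thesis
    unfolding dpsi_def dpsi_inv_def c_def[symmetric] by simp
qed

lemma dpsi_inv_dpsi:
  assumes "0 < s" "s < p $ i / (1 - \<alpha>)"
  shows "dpsi_inv p \<alpha> i (dpsi p \<alpha> i s) = s"
proof -
  define c where "c = p $ i / (1 - \<alpha>)"
  have "1 + s / (c - s) = c / (c - s)"
    using assms unfolding c_def[symmetric] by (simp add: field_simps)
  then show ?thesis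
    using assms unfolding dpsi_def dpsi_inv_def c_def[symmetric] by (simp add: field_simps)
qed

definition grad_psi :: "real^'n \<Rightarrow> real \<Rightarrow> real^'n \<Rightarrow> real^'n" where
  "grad_psi p \<alpha> r = (\<chi> i. dpsi p \<alpha> i (r $ i))"

definition D_psi :: "real^'n \<Rightarrow> real \<Rightarrow> real^'n \<Rightarrow> real^'n \<Rightarrow> ereal" where
  "D_psi p \<alpha> q r = psi p \<alpha> q - psi p \<alpha> r - ereal (grad_psi p \<alpha> r \<bullet> (q - r))"

definition block_prox :: "real^'n \<Rightarrow> real \<Rightarrow> 'a set \<Rightarrow> ('a \<Rightarrow> 'n \<Rightarrow> real) \<Rightarrow> 'n set \<Rightarrow> real
    \<Rightarrow> real^'n \<Rightarrow> (real^'n) set" where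
  "block_prox p \<alpha> X F B \<gamma> r =
     {q. is_arg_min (\<lambda>q. ereal \<gamma> * phi X F q + D_psi p \<alpha> q r)
           (\<lambda>q. q \<in> Q_set p \<alpha> \<and> (\<forall>i\<in>- B. q $ i = r $ i)) q}"

definition h_fun :: "real^'n \<Rightarrow> real \<Rightarrow> ('a \<Rightarrow> 'n \<Rightarrow> real) \<Rightarrow> real \<Rightarrow> real^'n \<Rightarrow> 'n
    \<Rightarrow> 'a \<Rightarrow> real \<Rightarrow> real" where
  "h_fun p \<alpha> F \<gamma> r i x t = ln (1 + exp (dpsi p \<alpha> i (r $ i) + \<gamma> * (F x i - t)))"

definition block_update :: "real^'n \<Rightarrow> real \<Rightarrow> ('a \<Rightarrow> 'n \<Rightarrow> real) \<Rightarrow> 'n set \<Rightarrow> real \<Rightarrow> real^'n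
    \<Rightarrow> 'a \<Rightarrow> real \<Rightarrow> real^'n" where
  "block_update p \<alpha> F B \<gamma> r x t =
     (\<chi> i. if i \<in> B then dpsi_inv p \<alpha> i (dpsi p \<alpha> i (r $ i) + \<gamma> * (F x i - t)) else r $ i)"

definition block_objective :: "real^'n \<Rightarrow> real \<Rightarrow> ('a \<Rightarrow> 'n \<Rightarrow> real) \<Rightarrow> 'n set \<Rightarrow> real \<Rightarrow> real^'n
    \<Rightarrow> 'a \<Rightarrow> real \<Rightarrow> real" where
  "block_objective p \<alpha> F B \<gamma> r x t =
     t + (\<Sum>i\<in>- B. r $ i * (F x i - t))
       + 1 / (\<gamma> * (1 - \<alpha>)) * (\<Sum>i\<in>B. p $ i * h_fun p \<alpha> F \<gamma> r i x t)"

end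

theory Submission imports Defs begin

text \<open>Let \<open>q\<close> be the update vector at a minimizer of the block objective. The derivative of the
  objective along \<open>(x - xhat, e)\<close>, bounded above through the convexity of \<open>F\<close>, is
  \<open>e + (\<Sum>i. q\<^sub>i (F\<^sub>i(x) - F\<^sub>i(xhat) - e))\<close>, so it is nonnegative for every \<open>x \<in> X\<close> and real \<open>e\<close>.
  Taking \<open>x = xhat\<close> and \<open>e = \<plusminus>1\<close> gives \<open>\<Sum>i. q\<^sub>i = 1\<close>; taking \<open>e = 0\<close> shows that \<open>xhat\<close> minimizes
  the expectation under \<open>q\<close>, so that \<open>(q, xhat)\<close> is a saddle point. Optimality and uniqueness of
  \<open>q\<close> in the proximal problem then follow from the strict tangent inequality for the entropy, as
  \<open>\<nabla>\<^sub>i\<psi>(q\<^sub>i) - \<nabla>\<^sub>i\<psi>(r\<^sub>i) = \<gamma> (F\<^sub>i(xhat) - that)\<close> on the block.\<close>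

section \<open>Tangent inequalities for the entropy\<close>

lemma x_ln_x_tangent:
  fixes q u :: real
  assumes "0 \<le> q" "0 < u"
  shows "q * ln u + q - u \<le> q * ln q"
    and "q \<noteq> u \<Longrightarrow> q * ln u + q - u < q * ln q"
proof -
  have strict: "q * ln u + q - u < q * ln q" if ne: "q \<noteq> u"
  proof (cases "q = 0")
    case True
    then show ?thesis using assms by simp
  next
    case False
    then have q: "q > 0" using assms by simp
    \<comment> \<open>The bound \<open>ln z \<le> z - 1\<close>, with equality only at
      \<open>z = 1\<close>, is used at \<open>z = u / q\<close> and then multiplied by
      \<open>q\<close>.\<close>
    have "ln (u / q) \<noteq> u / q - 1"
      using ln_eq_minus_one[of "u / q"] q assms ne by auto
    moreover have "ln (u / q) \<le> u / q - 1"
      using q assms by (intro ln_le_minus_one) simp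
    ultimately have "q * ln (u / q) < q * (u / q - 1)"
      using q by simp
    then show ?thesis
      using q assms by (simp add: ln_div algebra_simps)
  qed
  then show "q \<noteq> u \<Longrightarrow> q * ln u + q - u < q * ln q" .
  show "q * ln u + q - u \<le> q * ln q"
    using strict by (cases "q = u") (auto simp: less_imp_le)
qed

text \<open>The entropy term is \<open>x ln x\<close> at \<open>q\<close> plus \<open>x ln x\<close>
  at \<open>c i - q\<close>. Adding the two tangent inequalities cancels the linear corrections
  \<open>q - u\<close> and \<open>u - q\<close>. The endpoints of the box are allowed for
  \<open>q\<close>, so boundary competitors are covered.\<close>

lemma fermi_dirac_tangent:
  fixes p :: "real^'n" and \<alpha> :: real
  defines "c \<equiv> \<lambda>i. p $ i / (1 - \<alpha>)"
  assumes "0 \<le> q" "q \<le> c i" "0 < u" "u < c i"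
  shows "u * ln u + (c i - u) * ln (c i - u) + dpsi p \<alpha> i u * (q - u)
           \<le> q * ln q + (c i - q) * ln (c i - q)"
    and "q \<noteq> u \<Longrightarrow> u * ln u + (c i - u) * ln (c i - u) + dpsi p \<alpha> i u * (q - u)
           < q * ln q + (c i - q) * ln (c i - q)"
proof -
  have dpsi_u: "dpsi p \<alpha> i u = ln u - ln (c i - u)"
    using assms unfolding dpsi_def by (simp add: ln_div)
  have eq: "u * ln u + (c i - u) * ln (c i - u) + dpsi p \<alpha> i u * (q - u)
      = (q * ln u + q - u) + ((c i - q) * ln (c i - u) + (c i - q) - (c i - u))"
    unfolding dpsi_u by (simp add: algebra_simps)
  have c: "0 \<le> c i - q" "0 < c i - u" using assms by auto
  show "u * ln u + (c i - u) * ln (c i - u) + dpsi p \<alpha> i u * (q - u)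
           \<le> q * ln q + (c i - q) * ln (c i - q)"
    unfolding eq by (intro add_mono x_ln_x_tangent assms c)
  assume "q \<noteq> u"
  then show "u * ln u + (c i - u) * ln (c i - u) + dpsi p \<alpha> i u * (q - u)
           < q * ln q + (c i - q) * ln (c i - q)"
    unfolding eq by (intro add_less_le_mono x_ln_x_tangent assms c)
qed

lemma dpsi_inv_bounds:
  assumes "0 < p $ i / (1 - \<alpha>)"
  shows "0 < dpsi_inv p \<alpha> i s" and "dpsi_inv p \<alpha> i s < p $ i / (1 - \<alpha>)"
proof -
  have e: "0 < exp s / (1 + exp s)" "exp s / (1 + exp s) < 1"
    by (auto simp: add_pos_pos divide_simps)
  show "0 < dpsi_inv p \<alpha> i s"
    unfolding dpsi_inv_def using assms e by (intro mult_pos_pos)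
  show "dpsi_inv p \<alpha> i s < p $ i / (1 - \<alpha>)"
    unfolding dpsi_inv_def using mult_strict_left_mono[OF e(2) assms] by simp
qed

section \<open>First-order condition for the block objective\<close>

lemma sum_split_block:
  fixes B :: "'n::finite set"
  shows "(\<Sum>i\<in>UNIV. f i) = (\<Sum>i\<in>- B. f i) + (\<Sum>i\<in>B. f i)"
  using sum.subset_diff[of B UNIV f] by (simp add: Compl_eq_Diff_UNIV)

text \<open>The objective is polymorphic in the decision space, so its restriction to a segment is
  treated as an objective over the real line with affine losses \<open>L\<close>. Here
  \<open>b\<close> is the slope of the losses and \<open>e\<close> that of \<open>t\<close>.\<close>

lemma block_objective_has_derivative:
  fixes a b :: "'n::finite \<Rightarrow> real"
  assumes "\<gamma> \<noteq> 0"
  defines "L \<equiv> \<lambda>u i. a i + u * b i"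
  shows "((\<lambda>u. block_objective p \<alpha> L B \<gamma> r u (t + u * e)) has_real_derivative
            e + (\<Sum>i\<in>UNIV. block_update p \<alpha> L B \<gamma> r 0 t $ i * (b i - e))) (at 0)"
proof -
  have h: "((\<lambda>u. h_fun p \<alpha> L \<gamma> r i u (t + u * e)) has_real_derivative
      exp (dpsi p \<alpha> i (r $ i) + \<gamma> * (L 0 i - t)) /
        (1 + exp (dpsi p \<alpha> i (r $ i) + \<gamma> * (L 0 i - t))) * (\<gamma> * (b i - e))) (at 0)" for i
  proof -
    have "1 + exp z > 0" for z :: real by (simp add: add_pos_pos)
    then show ?thesis
      unfolding h_fun_def L_def
      by (auto intro!: derivative_eq_intros simp: field_simps)
  qed
  have d: "((\<lambda>u. block_objective p \<alpha> L B \<gamma> r u (t + u * e)) has_real_derivative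
      e + (\<Sum>i\<in>- B. r $ i * (b i - e)) + 1 / (\<gamma> * (1 - \<alpha>)) *
        (\<Sum>i\<in>B. p $ i * (exp (dpsi p \<alpha> i (r $ i) + \<gamma> * (L 0 i - t)) /
          (1 + exp (dpsi p \<alpha> i (r $ i) + \<gamma> * (L 0 i - t))) * (\<gamma> * (b i - e))))) (at 0)"
    unfolding block_objective_def
    by (intro DERIV_add DERIV_cmult DERIV_sum h)
       (auto simp: L_def intro!: derivative_eq_intros)
  \<comment> \<open>The inner factor \<open>\<gamma>\<close> cancels \<open>1 / \<gamma>\<close>,
    and \<open>p $ i / (1 - \<alpha>)\<close> times the logistic function is
    \<open>dpsi_inv\<close>.\<close>
  have "(\<Sum>i\<in>- B. r $ i * (b i - e)) + 1 / (\<gamma> * (1 - \<alpha>)) *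
        (\<Sum>i\<in>B. p $ i * (exp (dpsi p \<alpha> i (r $ i) + \<gamma> * (L 0 i - t)) /
          (1 + exp (dpsi p \<alpha> i (r $ i) + \<gamma> * (L 0 i - t))) * (\<gamma> * (b i - e))))
      = (\<Sum>i\<in>UNIV. block_update p \<alpha> L B \<gamma> r 0 t $ i * (b i - e))"
    unfolding sum_split_block[of _ B] sum_distrib_left
    using assms(1) by (intro arg_cong2[where f = "(+)"] sum.cong)
      (auto simp: block_update_def dpsi_inv_def)
  with d show ?thesis by (simp add: add.assoc)
qed

text \<open>Every loss enters increasingly, with a nonnegative weight. The points \<open>x\<close>
  and \<open>y\<close> may lie in different decision spaces, which allows a comparison of
  \<open>F\<close> on a segment with a majorant parametrized by a real number.\<close>

lemma block_objective_mono:
  assumes "\<And>i. F x i \<le> G y i" "\<And>i. 0 \<le> p $ i" "\<And>i. 0 \<le> r $ i" "\<alpha> < 1" "0 < \<gamma>"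
  shows "block_objective p \<alpha> F B \<gamma> r x t \<le> block_objective p \<alpha> G B \<gamma> r y t"
proof -
  have h: "h_fun p \<alpha> F \<gamma> r i x t \<le> h_fun p \<alpha> G \<gamma> r i y t" for i
    unfolding h_fun_def
    using assms(1)[of i] assms(5) by (auto simp: ln_le_cancel_iff add_pos_pos)
  show ?thesis
    unfolding block_objective_def
    using assms by (intro add_mono mult_left_mono sum_mono h) auto
qed

text \<open>Since \<open>F\<close> need not be differentiable, the losses on the segment from
  \<open>xhat\<close> to \<open>x\<close> are replaced by their chords \<open>L\<close>. By
  convexity these lie above \<open>F\<close> and agree with it at \<open>xhat\<close>, so the smooth
  function \<open>g\<close> still has its least value over \<open>[0, 1)\<close> at 0, and its
  derivative there cannot be negative.\<close>

lemma block_objective_first_order: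
  fixes X :: "'a::real_vector set"
  assumes "convex X" and convex_F: "\<And>i. convex_on X (\<lambda>x. F x i)"
    and "\<And>i. 0 \<le> p $ i" "\<And>i. 0 \<le> r $ i" "\<alpha> < 1" "0 < \<gamma>"
    and min: "is_arg_min (\<lambda>(x, t). block_objective p \<alpha> F B \<gamma> r x t) (\<lambda>(x, t). x \<in> X) (xhat, that)"
    and "x \<in> X"
  shows "0 \<le> e + (\<Sum>i\<in>UNIV. block_update p \<alpha> F B \<gamma> r xhat that $ i * (F x i - F xhat i - e))"
    (is "0 \<le> ?D")
proof (rule ccontr)
  define L where "L = (\<lambda>u i. F xhat i + u * (F x i - F xhat i))"
  define g where "g = (\<lambda>u. block_objective p \<alpha> L B \<gamma> r u (that + u * e))"
  have xhat: "xhat \<in> X"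
    and min': "\<And>y s. y \<in> X \<Longrightarrow> block_objective p \<alpha> F B \<gamma> r xhat that \<le> block_objective p \<alpha> F B \<gamma> r y s"
    using min by (auto simp: is_arg_min_def not_less)
  have "block_update p \<alpha> L B \<gamma> r 0 that = block_update p \<alpha> F B \<gamma> r xhat that"
    by (simp add: block_update_def L_def vec_eq_iff)
  then have deriv: "(g has_real_derivative ?D) (at 0)"
    using block_objective_has_derivative[of \<gamma> p \<alpha> "F xhat" "\<lambda>i. F x i - F xhat i" B r that e] \<open>0 < \<gamma>\<close>
    by (simp add: g_def L_def)
  have g0: "g 0 = block_objective p \<alpha> F B \<gamma> r xhat that"
    by (simp add: g_def L_def block_objective_def h_fun_def)
  have ge: "g 0 \<le> g u" if u: "0 < u" "u < 1" for u
  proof -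
    define y where "y = (1 - u) *\<^sub>R xhat + u *\<^sub>R x"
    have "y \<in> X"
      unfolding y_def using convexD[OF \<open>convex X\<close> xhat \<open>x \<in> X\<close>] u by simp
    moreover have "F y i \<le> L u i" for i
      using convex_onD[OF convex_F, of u xhat x i] u xhat \<open>x \<in> X\<close>
      by (simp add: y_def L_def algebra_simps)
    ultimately show ?thesis
      unfolding g0 unfolding g_def
      using min' block_objective_mono[of F y L u p r \<alpha> \<gamma> B "that + u * e"] assms(3-6)
      by (meson order_trans)
  qed
  assume "\<not> 0 \<le> ?D"
  then obtain d where d: "0 < d" "\<And>h. 0 < h \<Longrightarrow> h < d \<Longrightarrow> g h < g 0"
    using DERIV_neg_dec_right[OF deriv] by auto
  \<comment> \<open>A step short enough for the local decrease of \<open>g\<close> that also stays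
    inside the segment.\<close>
  have "0 < min (d / 2) (1 / 2)" "min (d / 2) (1 / 2) < d" "min (d / 2) (1 / 2) < 1"
    using d(1) by auto
  with d(2) ge show False by (meson not_less)
qed

section \<open>Optimality in the proximal problem\<close>

lemma phi_ge:
  assumes "(\<Sum>i\<in>UNIV. q $ i) = 1" "x \<in> X"
  shows "ereal (- expect q F x) \<le> phi X F q"
proof -
  have "(INF x\<in>X. ereal (expect q F x)) \<le> ereal (expect q F x)"
    using assms(2) by (rule INF_lower)
  then show ?thesis
    using assms(1) by (simp add: phi_def flip: uminus_ereal.simps(1))
qed

lemma phi_eq:
  assumes "(\<Sum>i\<in>UNIV. q $ i) = 1" "x \<in> X" "\<And>y. y \<in> X \<Longrightarrow> expect q F x \<le> expect q F y"
  shows "phi X F q = ereal (- expect q F x)"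
proof -
  have "(INF x\<in>X. ereal (expect q F x)) = ereal (expect q F x)"
    using assms(2,3) by (intro antisym INF_lower INF_greatest) auto
  then show ?thesis
    using assms(1) by (simp add: phi_def)
qed

lemma Q_setD:
  assumes "q \<in> Q_set p \<alpha>"
  shows "q \<in> Q_box p \<alpha>" "(\<Sum>i\<in>UNIV. q $ i) = 1"
    "0 \<le> q $ i" "q $ i \<le> p $ i / (1 - \<alpha>)"
  using assms by (auto simp: Q_set_def Q_box_def)

lemma prox_objective_less:
  fixes q u r :: "real^'n"
  assumes "0 < \<gamma>"
    and r: "r \<in> int_Q p \<alpha>" and u: "u \<in> int_Q p \<alpha>" and q: "q \<in> Q_set p \<alpha>"
    and off: "\<And>i. i \<notin> B \<Longrightarrow> u $ i = r $ i" "\<And>i. i \<notin> B \<Longrightarrow> q $ i = r $ i"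
    and on: "\<And>i. i \<in> B \<Longrightarrow> dpsi p \<alpha> i (u $ i) = dpsi p \<alpha> i (r $ i) + \<gamma> * (F xhat i - that)"
    and xhat: "xhat \<in> X" "\<And>x. x \<in> X \<Longrightarrow> expect u F xhat \<le> expect u F x"
    and ne: "q \<noteq> u"
  shows "ereal \<gamma> * phi X F u + D_psi p \<alpha> u r < ereal \<gamma> * phi X F q + D_psi p \<alpha> q r"
proof -
  \<comment> \<open>\<open>H\<close> and \<open>D\<close> are real-valued versions of the entropy
    and of the divergence from \<open>r\<close>; they agree with the extended ones on
    \<open>Q_set\<close>, where all points compared lie.\<close>
  define H where "H = (\<lambda>q :: real^'n. \<Sum>i\<in>UNIV. q $ i * ln (q $ i)
      + (p $ i / (1 - \<alpha>) - q $ i) * ln (p $ i / (1 - \<alpha>) - q $ i))"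
  define D where "D = (\<lambda>q. H q - H r - grad_psi p \<alpha> r \<bullet> (q - r))"
  have uQ: "u \<in> Q_set p \<alpha>" and rQ: "r \<in> Q_set p \<alpha>"
    using u r by (auto simp: int_Q_def)
  have D: "D_psi p \<alpha> v r = ereal (D v)" if "v \<in> Q_set p \<alpha>" for v
    using that rQ by (simp add: D_psi_def psi_def D_def H_def Q_setD)
  have phi_u: "phi X F u = ereal (- expect u F xhat)"
    using Q_setD(2)[OF uQ] xhat by (rule phi_eq)
  obtain j where j: "q $ j \<noteq> u $ j" using ne by (auto simp: vec_eq_iff)
  have ub: "0 < u $ i" "u $ i < p $ i / (1 - \<alpha>)" for i
    using u by (auto simp: int_Q_def)
  have "H u + (\<Sum>i\<in>UNIV. dpsi p \<alpha> i (u $ i) * (q $ i - u $ i)) < H q"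
    unfolding H_def sum.distrib[symmetric]
  proof (rule sum_strict_mono_ex1)
    show "\<forall>i\<in>UNIV. u $ i * ln (u $ i) + (p $ i / (1 - \<alpha>) - u $ i) * ln (p $ i / (1 - \<alpha>) - u $ i)
        + dpsi p \<alpha> i (u $ i) * (q $ i - u $ i)
        \<le> q $ i * ln (q $ i) + (p $ i / (1 - \<alpha>) - q $ i) * ln (p $ i / (1 - \<alpha>) - q $ i)"
      by (intro ballI fermi_dirac_tangent Q_setD[OF q] ub)
    show "\<exists>i\<in>UNIV. u $ i * ln (u $ i) + (p $ i / (1 - \<alpha>) - u $ i) * ln (p $ i / (1 - \<alpha>) - u $ i)
        + dpsi p \<alpha> i (u $ i) * (q $ i - u $ i)
        < q $ i * ln (q $ i) + (p $ i / (1 - \<alpha>) - q $ i) * ln (p $ i / (1 - \<alpha>) - q $ i)"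
      by (intro bexI[of _ j] fermi_dirac_tangent Q_setD[OF q] ub j UNIV_I)
  qed simp
  \<comment> \<open>On the block the gradient at \<open>u\<close> is rewritten by \<open>on\<close>;
    off the block \<open>q\<close> and \<open>u\<close> agree, so both sides vanish.\<close>
  also have "(\<Sum>i\<in>UNIV. dpsi p \<alpha> i (u $ i) * (q $ i - u $ i))
      = (\<Sum>i\<in>UNIV. dpsi p \<alpha> i (r $ i) * (q $ i - u $ i)
          + \<gamma> * (q $ i * F xhat i - u $ i * F xhat i) - \<gamma> * that * (q $ i - u $ i))"
  proof (rule sum.cong)
    fix i
    show "dpsi p \<alpha> i (u $ i) * (q $ i - u $ i) = dpsi p \<alpha> i (r $ i) * (q $ i - u $ i)
          + \<gamma> * (q $ i * F xhat i - u $ i * F xhat i) - \<gamma> * that * (q $ i - u $ i)"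
      by (cases "i \<in> B") (simp_all add: on off algebra_simps)
  qed simp
  also have "\<dots> = grad_psi p \<alpha> r \<bullet> (q - u) + \<gamma> * (expect q F xhat - expect u F xhat)
      - \<gamma> * that * ((\<Sum>i\<in>UNIV. q $ i) - (\<Sum>i\<in>UNIV. u $ i))"
    by (simp add: sum.distrib sum_subtractf inner_vec_def grad_psi_def expect_def
        flip: sum_distrib_left)
  \<comment> \<open>Both vectors have total mass 1, which removes the multiplier
    \<open>that\<close>.\<close>
  also have "\<dots> = grad_psi p \<alpha> r \<bullet> (q - u) + \<gamma> * (expect q F xhat - expect u F xhat)"
    using Q_setD(2)[OF q] Q_setD(2)[OF uQ] by simp
  finally have "\<gamma> * (- expect u F xhat) + D u < \<gamma> * (- expect q F xhat) + D q"
    by (simp add: D_def inner_diff_right algebra_simps)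
  then have "ereal \<gamma> * phi X F u + D_psi p \<alpha> u r < ereal \<gamma> * ereal (- expect q F xhat) + D_psi p \<alpha> q r"
    by (simp add: phi_u D uQ q)
  \<comment> \<open>The point \<open>xhat\<close> is optimal for \<open>u\<close> but perhaps not
    for \<open>q\<close>; for \<open>q\<close> a lower bound on \<open>phi\<close> suffices.\<close>
  also have "\<dots> \<le> ereal \<gamma> * phi X F q + D_psi p \<alpha> q r"
    using phi_ge[OF Q_setD(2)[OF q] xhat(1)] \<open>0 < \<gamma>\<close>
    by (intro add_right_mono ereal_mult_left_mono) auto
  finally show ?thesis .
qed

theorem corollary2p9:
  fixes p :: "real^'n" and \<alpha> :: real
    and X :: "(real^'d) set" and F :: "real^'d \<Rightarrow> 'n \<Rightarrow> real"
    and B :: "'n set"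
  assumes "prob_vector p" and "0 < \<alpha>" and "\<alpha> < 1"
    and "closed X" and "convex X" and "X \<noteq> {}"
    and convex_F: "\<And>i. convex_on X (\<lambda>x. F x i)"
    and attained: "\<And>q. q \<in> Q_set p \<alpha> \<Longrightarrow> \<exists>x. is_arg_min (expect q F) (\<lambda>x. x \<in> X) x"
    and "card B \<ge> 2"
  shows "\<forall>r \<in> int_Q p \<alpha>. \<forall>\<gamma>>0. \<forall>xhat that.
           is_arg_min (\<lambda>(x, t). block_objective p \<alpha> F B \<gamma> r x t) (\<lambda>(x, t). x \<in> X) (xhat, that)
           \<longrightarrow> block_prox p \<alpha> X F B \<gamma> r = {block_update p \<alpha> F B \<gamma> r xhat that}
               \<and> block_update p \<alpha> F B \<gamma> r xhat that \<in> int_Q p \<alpha>"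
proof (intro ballI allI impI)
  fix r \<gamma> xhat that
  assume r: "r \<in> int_Q p \<alpha>" and \<gamma>: "0 < (\<gamma>::real)"
    and min: "is_arg_min (\<lambda>(x, t). block_objective p \<alpha> F B \<gamma> r x t) (\<lambda>(x, t). x \<in> X) (xhat, that)"
  define u where "u = block_update p \<alpha> F B \<gamma> r xhat that"
  have rb: "0 < r $ i" "r $ i < p $ i / (1 - \<alpha>)" for i
    using r by (auto simp: int_Q_def)
  \<comment> \<open>The existence of an interior point \<open>r\<close> forces every box width to be
    positive.\<close>
  have c: "0 < p $ i / (1 - \<alpha>)" for i
    using rb[of i] by linarith
  have xhat: "xhat \<in> X" using min by (simp add: is_arg_min_def)
  have p: "0 \<le> p $ i" for i using assms(1) by (simp add: prob_vector_def)
  have fo: "0 \<le> e + (\<Sum>i\<in>UNIV. u $ i * (F x i - F xhat i - e))" if "x \<in> X" for x e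
    unfolding u_def
    using p rb(1) by (intro block_objective_first_order[OF assms(5) convex_F _ _ assms(3) \<gamma> min that])
      (auto simp: less_imp_le)
  have sum1: "(\<Sum>i\<in>UNIV. u $ i) = 1"
    using fo[OF xhat, of 1] fo[OF xhat, of "-1"] by (simp add: sum_negf)
  have ub: "0 < u $ i \<and> u $ i < p $ i / (1 - \<alpha>)" for i
    using dpsi_inv_bounds[OF c] rb[of i] by (simp add: u_def block_update_def)
  have u: "u \<in> int_Q p \<alpha>"
    using ub sum1 by (auto simp: int_Q_def Q_set_def Q_box_def less_imp_le)
  have uQ: "u \<in> Q_set p \<alpha>" using u by (simp add: int_Q_def)
  have opt: "expect u F xhat \<le> expect u F x" if "x \<in> X" for x
    using fo[OF that, of 0] by (simp add: expect_def right_diff_distrib sum_subtractf)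
  have off: "u $ i = r $ i" if "i \<notin> B" for i
    using that by (simp add: u_def block_update_def)
  have on: "dpsi p \<alpha> i (u $ i) = dpsi p \<alpha> i (r $ i) + \<gamma> * (F xhat i - that)" if "i \<in> B" for i
    using that dpsi_dpsi_inv[OF c] by (simp add: u_def block_update_def)
  \<comment> \<open>Strictness against every other feasible point yields minimality and uniqueness
    at once.\<close>
  have less: "ereal \<gamma> * phi X F u + D_psi p \<alpha> u r < ereal \<gamma> * phi X F q + D_psi p \<alpha> q r"
    if "q \<in> Q_set p \<alpha>" "\<forall>i\<in>- B. q $ i = r $ i" "q \<noteq> u" for q
    by (rule prox_objective_less[where B = B and F = F and xhat = xhat and that = that])
      (use that \<gamma> r u off on xhat opt in auto)
  have "is_arg_min (\<lambda>q. ereal \<gamma> * phi X F q + D_psi p \<alpha> q r)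
      (\<lambda>q. q \<in> Q_set p \<alpha> \<and> (\<forall>i\<in>- B. q $ i = r $ i)) q \<longleftrightarrow> q = u" for q
  proof
    assume "q = u"
    then show "is_arg_min (\<lambda>q. ereal \<gamma> * phi X F q + D_psi p \<alpha> q r)
        (\<lambda>q. q \<in> Q_set p \<alpha> \<and> (\<forall>i\<in>- B. q $ i = r $ i)) q"
      using uQ off less by (auto simp: is_arg_min_def) (metis ComplI less_asym less_irrefl)
  next
    assume "is_arg_min (\<lambda>q. ereal \<gamma> * phi X F q + D_psi p \<alpha> q r)
        (\<lambda>q. q \<in> Q_set p \<alpha> \<and> (\<forall>i\<in>- B. q $ i = r $ i)) q"
    then show "q = u"
      using uQ off less unfolding is_arg_min_def by (metis ComplD)
  qed
  then show "block_prox p \<alpha> X F B \<gamma> r = {block_update p \<alpha> F B \<gamma> r xhat that}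
               \<and> block_update p \<alpha> F B \<gamma> r xhat that \<in> int_Q p \<alpha>"
    using u unfolding block_prox_def u_def[symmetric] by auto
qed

end
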